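(* Let $K$ be a finite abstract simplicial complex with geometric realization $|K|$. Then $\mathrm{cat}\,|K|\leq\mathrm{scat}\,K$.
   Context: Two simplicial maps $\varphi,\psi\colon K\to L$ between abstract simplicial complexes are contiguous, $\varphi\sim_c\psi$, if for every simplex $\sigma$ of $K$ the set of vertices $\varphi(\sigma)\cup\psi(\sigma)$ is a simplex of $L$. They are in the same contiguity class, $\varphi\sim\psi$, if there is a finite sequence of simplicial maps $\varphi=\varphi_1\sim_c\varphi_2\sim_c\cdots\sim_c\varphi_m=\psi$ from $K$ to $L$. A subcomplex $U\subset K$ is categorical (in $K$) if there is a vertex $v\in K$ such that the inclusion $U\to K$ and the constant map $c_v\colon U\to K$ with value $v$ are in the same contiguity class. The simplicial LS-category $\mathrm{scat}\, K$ is the least integer $n\geq 0$ such that $K=U_0\cup\cdots\cup U_n$ for some $n+1$ categorical subcomplexes $U_0,\dots,U_n$ of $K$. Complexes are assumed nonempty. For a topological space $X$, an open subset $U\subset X$ is categorical if it can be contracted to a point inside $X$ (the inclusion $U\to X$ is homotopic to a constant map). The LS-category $\mathrm{cat}\,X$ is the least integer $n\geq 0$ such that $X$ is covered by $n+1$ categorical open subsets. *)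

theory Defs
  imports "HOL-Analysis.Analysis"
begin

section \<open>Abstract simplicial complexes and contiguity\<close>

text \<open>A complex is given by its set of (nonempty) simplices; its vertex set is \<open>\<Union>K\<close>.\<close>

definition abstract_simplicial_complex :: "'a set set \<Rightarrow> bool" where
  "abstract_simplicial_complex K \<longleftrightarrow>
     K \<noteq> {} \<and>
     (\<forall>\<sigma>\<in>K. finite \<sigma> \<and> \<sigma> \<noteq> {}) \<and>
     (\<forall>\<sigma>\<in>K. \<forall>\<tau>. \<tau> \<subseteq> \<sigma> \<and> \<tau> \<noteq> {} \<longrightarrow> \<tau> \<in> K)"

definition subcomplex :: "'a set set \<Rightarrow> 'a set set \<Rightarrow> bool" where
  "subcomplex U K \<longleftrightarrow> abstract_simplicial_complex U \<and> U \<subseteq> K"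

text \<open>Simplicial maps are represented by total functions on the vertex type. Values outside
  \<open>\<Union>K\<close> are irrelevant: simplicial functions that agree on \<open>\<Union>K\<close> are contiguous.\<close>

definition simplicial_map :: "'a set set \<Rightarrow> 'b set set \<Rightarrow> ('a \<Rightarrow> 'b) \<Rightarrow> bool" where
  "simplicial_map K L \<phi> \<longleftrightarrow> (\<forall>\<sigma>\<in>K. \<phi> ` \<sigma> \<in> L)"

definition contiguous :: "'a set set \<Rightarrow> 'b set set \<Rightarrow> ('a \<Rightarrow> 'b) \<Rightarrow> ('a \<Rightarrow> 'b) \<Rightarrow> bool" where
  "contiguous K L \<phi> \<psi> \<longleftrightarrow>
     simplicial_map K L \<phi> \<and> simplicial_map K L \<psi> \<and> (\<forall>\<sigma>\<in>K. \<phi> ` \<sigma> \<union> \<psi> ` \<sigma> \<in> L)"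

definition same_contiguity_class ::
  "'a set set \<Rightarrow> 'b set set \<Rightarrow> ('a \<Rightarrow> 'b) \<Rightarrow> ('a \<Rightarrow> 'b) \<Rightarrow> bool" where
  "same_contiguity_class K L \<phi> \<psi> \<longleftrightarrow>
     simplicial_map K L \<phi> \<and> simplicial_map K L \<psi> \<and> (contiguous K L)\<^sup>*\<^sup>* \<phi> \<psi>"

definition categorical_subcomplex :: "'a set set \<Rightarrow> 'a set set \<Rightarrow> bool" where
  "categorical_subcomplex K U \<longleftrightarrow>
     subcomplex U K \<and> (\<exists>v\<in>\<Union>K. same_contiguity_class U K id (\<lambda>_. v))"

text \<open>Both categories below take the value \<open>\<infinity>\<close> when no finite cover exists.\<close>

definition scat :: "'a set set \<Rightarrow> enat" where
  "scat K = Inf {enat n | n. \<exists>U :: nat \<Rightarrow> 'a set set.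
     (\<forall>i\<le>n. categorical_subcomplex K (U i)) \<and> K = (\<Union>i\<le>n. U i)}"


section \<open>Lusternik--Schnirelmann category of a space\<close>

definition categorical_open :: "'a topology \<Rightarrow> 'a set \<Rightarrow> bool" where
  "categorical_open X U \<longleftrightarrow>
     openin X U \<and>
     (\<exists>a\<in>topspace X. homotopic_with (\<lambda>_. True) (subtopology X U) X id (\<lambda>_. a))"

definition LS_cat :: "'a topology \<Rightarrow> enat" where
  "LS_cat X = Inf {enat n | n. \<exists>U :: nat \<Rightarrow> 'a set.
     (\<forall>i\<le>n. categorical_open X (U i)) \<and> topspace X = (\<Union>i\<le>n. U i)}"


section \<open>Geometric realization\<close>

text \<open>Points are given by their barycentric coordinates. The topology is induced from the
  product topology on \<open>'a \<Rightarrow> real\<close>; for finite complexes this is the Euclidean topology on the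
  finitely many relevant coordinates and agrees with the weak topology, but for infinite
  complexes it can be coarser than the latter.\<close>

definition geometric_realization :: "'a set set \<Rightarrow> ('a \<Rightarrow> real) topology" where
  "geometric_realization K =
     top_of_set {x. (\<forall>v. 0 \<le> x v) \<and> {v. x v \<noteq> 0} \<in> K \<and> (\<Sum>v | x v \<noteq> 0. x v) = 1}"

end

theory Submission
  imports Defs
begin

text \<open>
  For points \<open>x\<close> of \<open>|K|\<close> the superlevel sets \<open>{v. x v > t}\<close> form a chain, which is the carrier of
  \<open>x\<close> in the barycentric subdivision. If one of them lies in the subcomplex \<open>U\<close>, averaging
  the superlevel sets that lie in \<open>U\<close> with continuous weights gives a point of \<open>|U|\<close> in the closed
  carrier of \<open>x\<close>. The set \<open>W\<close> of all such \<open>x\<close> is therefore an open neighbourhood of \<open>|U|\<close> whose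
  inclusion in \<open>|K|\<close> is linearly homotopic to a map \<open>r : W \<rightarrow> |U|\<close>. Contiguous maps have linearly
  homotopic realizations, so a contiguity chain from the inclusion of \<open>U\<close> to a constant,
  precomposed with \<open>r\<close>, contracts \<open>W\<close> inside \<open>|K|\<close>.
\<close>

section \<open>Points of the realization in barycentric coordinates\<close>

definition realization_points :: "'a set set \<Rightarrow> ('a \<Rightarrow> real) set" where
  "realization_points K =
     {x. (\<forall>v. 0 \<le> x v) \<and> {v. x v \<noteq> 0} \<in> K \<and> (\<Sum>v | x v \<noteq> 0. x v) = 1}"

lemma geometric_realization_eq: "geometric_realization K = top_of_set (realization_points K)"
  by (simp add: geometric_realization_def realization_points_def)

text \<open>The defining sum runs over the support, which varies with \<open>x\<close>. A fixed
  finite index set \<open>V\<close> makes sums linear in \<open>x\<close> and lets double sums be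
  interchanged.\<close>

lemma mem_realization_points_iff:
  assumes "finite V" "\<Union>K \<subseteq> V"
  shows "x \<in> realization_points K \<longleftrightarrow> (\<forall>v. 0 \<le> x v) \<and> {v. x v \<noteq> 0} \<in> K \<and> sum x V = 1"
proof -
  have "sum x {v. x v \<noteq> 0} = sum x V" if "{v. x v \<noteq> 0} \<in> K"
    using assms that by (intro sum.mono_neutral_left) auto
  then show ?thesis
    by (auto simp: realization_points_def)
qed

lemma realization_points_mono: "U \<subseteq> K \<Longrightarrow> realization_points U \<subseteq> realization_points K"
  by (auto simp: realization_points_def)

lemma finite_vertices:
  assumes "abstract_simplicial_complex K" "finite K"
  shows "finite (\<Union>K)"
  using assms by (auto simp: abstract_simplicial_complex_def)

lemma face_mem:
  assumes "abstract_simplicial_complex K" "\<sigma> \<in> K" "\<tau> \<subseteq> \<sigma>" "\<tau> \<noteq> {}"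
  shows "\<tau> \<in> K"
  using assms unfolding abstract_simplicial_complex_def by blast

lemma continuous_on_coordinate:
  fixes f :: "'c::topological_space \<Rightarrow> 'a \<Rightarrow> real"
  assumes "continuous_on W f"
  shows "continuous_on W (\<lambda>x. f x v)"
  by (rule continuous_on_product_then_coordinatewise[OF assms])

section \<open>Straight-line homotopies\<close>

text \<open>The segment from \<open>f x\<close> to \<open>g x\<close> has its supports inside the
  union of the two supports, so it stays in one closed simplex of \<open>K\<close>.\<close>

lemma homotopic_if_common_simplex:
  fixes f g :: "'c::topological_space \<Rightarrow> 'a \<Rightarrow> real"
  assumes K: "abstract_simplicial_complex K" and fin: "finite (\<Union>K)"
    and cont: "continuous_on W f" "continuous_on W g"
    and f: "\<And>x. x \<in> W \<Longrightarrow> f x \<in> realization_points K"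
    and g: "\<And>x. x \<in> W \<Longrightarrow> g x \<in> realization_points K"
    and fg: "\<And>x. x \<in> W \<Longrightarrow> {v. f x v \<noteq> 0} \<union> {v. g x v \<noteq> 0} \<in> K"
  shows "homotopic_with_canon (\<lambda>_. True) W (realization_points K) f g"
proof -
  define h where "h = (\<lambda>(t::real, x) v. (1 - t) * f x v + t * g x v)"
  have "continuous_on ({0..1} \<times> W) (\<lambda>p. f (snd p))" "continuous_on ({0..1} \<times> W) (\<lambda>p. g (snd p))"
    by (rule continuous_on_compose2[OF cont(1)] continuous_on_compose2[OF cont(2)],
        auto intro: continuous_intros)+
  note coordinates = this[THEN continuous_on_coordinate]
  have "continuous_on ({0..1} \<times> W) h"
    unfolding h_def case_prod_beta
    by (intro continuous_on_coordinatewise_then_product continuous_on_add continuous_on_mult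
        continuous_on_diff continuous_on_const continuous_on_fst continuous_on_id coordinates)
  moreover have "h (t, x) \<in> realization_points K" if t: "0 \<le> t" "t \<le> 1" and x: "x \<in> W" for t x
  proof -
    note mem = mem_realization_points_iff[OF fin order_refl]
    have nonneg: "0 \<le> h (t, x) v" for v
      using f[OF x] g[OF x] t by (auto simp: h_def mem)
    have sum: "sum (h (t, x)) (\<Union>K) = 1"
      using f[OF x] g[OF x]
      by (simp add: h_def mem sum.distrib flip: sum_distrib_left)
    \<comment> \<open>Only nonempty subsets of a simplex count as faces; the coordinates sum to 1,
      so they cannot all vanish.\<close>
    have "{v. h (t, x) v \<noteq> 0} \<noteq> {}"
    proof
      assume "{v. h (t, x) v \<noteq> 0} = {}"
      then have "sum (h (t, x)) (\<Union>K) = 0"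
        by (intro sum.neutral) auto
      with sum show False by simp
    qed
    then have "{v. h (t, x) v \<noteq> 0} \<in> K"
      by (intro face_mem[OF K fg[OF x]]) (auto simp: h_def)
    with nonneg sum show ?thesis
      by (simp add: mem)
  qed
  ultimately show ?thesis
    unfolding homotopic_with_def
    by (intro exI[of _ h])
      (auto simp: h_def prod_topology_subtopology_eu continuous_map_in_subtopology)
qed

section \<open>Realizations of simplicial maps\<close>

text \<open>This is the affine extension of \<open>\<phi>\<close>: barycentric coordinates are
  summed over its fibres. Leaving \<open>V\<close> free allows the vertices of \<open>K\<close> to
  serve for every subcomplex \<open>U\<close>.\<close>

definition induced_map :: "'a set \<Rightarrow> ('a \<Rightarrow> 'b) \<Rightarrow> ('a \<Rightarrow> real) \<Rightarrow> 'b \<Rightarrow> real" where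
  "induced_map V \<phi> x w = (\<Sum>v\<in>V. if \<phi> v = w then x v else 0)"

lemma continuous_on_induced_map: "continuous_on W (induced_map V \<phi>)"
  unfolding induced_map_def[abs_def]
proof (intro continuous_on_coordinatewise_then_product continuous_on_sum)
  fix v w
  show "continuous_on W (\<lambda>x. if \<phi> v = w then x v else 0)"
    by (cases "\<phi> v = w") (simp_all add: continuous_on_coordinate[OF continuous_on_id])
qed

text \<open>Coordinates are nonnegative, so nothing cancels within a fibre of
  \<open>\<phi>\<close>.\<close>

lemma support_induced_map:
  assumes "finite V" "x \<in> realization_points U" "\<Union>U \<subseteq> V"
  shows "{w. induced_map V \<phi> x w \<noteq> 0} = \<phi> ` {v. x v \<noteq> 0}"
proof -
  have "\<And>v. 0 \<le> x v" and "{v. x v \<noteq> 0} \<subseteq> V"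
    using assms by (auto simp: realization_points_def)
  then show ?thesis
    using assms(1) by (auto simp: induced_map_def sum_nonneg_eq_0_iff)
qed

lemma induced_map_mem:
  assumes V: "finite V" "\<Union>U \<subseteq> V" and fin: "finite (\<Union>K)" and \<phi>: "simplicial_map U K \<phi>"
    and x: "x \<in> realization_points U"
  shows "induced_map V \<phi> x \<in> realization_points K"
proof -
  have nonneg: "\<And>v. 0 \<le> x v" and supp: "{v. x v \<noteq> 0} \<in> U" and sum: "sum x V = 1"
    using x V by (auto simp: mem_realization_points_iff[OF V])
  have image: "\<phi> ` {v. x v \<noteq> 0} \<in> K"
    using \<phi> supp by (auto simp: simplicial_map_def)
  have "sum (induced_map V \<phi> x) (\<Union>K) = (\<Sum>v\<in>V. \<Sum>w\<in>\<Union>K. if \<phi> v = w then x v else 0)"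
    unfolding induced_map_def by (rule sum.swap)
  \<comment> \<open>Off the vertices of \<open>U\<close>, \<open>\<phi>\<close> may leave the
    vertices of \<open>K\<close>, but there \<open>x v = 0\<close>. If \<open>x v\<close> is
    nonzero, then \<open>\<phi> v\<close> is a vertex of \<open>K\<close> by \<open>image\<close>,
    and the inner sum is \<open>x v\<close>.\<close>
  also have "\<dots> = sum x V"
    using image fin by (intro sum.cong refl) (auto simp: sum.delta)
  finally have "sum (induced_map V \<phi> x) (\<Union>K) = 1"
    using sum by simp
  moreover have "0 \<le> induced_map V \<phi> x w" for w
    unfolding induced_map_def using nonneg by (auto intro: sum_nonneg)
  ultimately show ?thesis
    using image
    by (simp add: mem_realization_points_iff[OF fin order_refl] support_induced_map[OF V(1) x V(2)])
qed

lemma induced_map_id: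
  assumes "finite V" "x \<in> realization_points U" "\<Union>U \<subseteq> V"
  shows "induced_map V id x = x"
proof
  fix v
  have "x v = 0" if "v \<notin> V"
    using assms that by (auto simp: realization_points_def)
  then show "induced_map V id x v = x v"
    using assms(1) by (auto simp: induced_map_def)
qed

lemma induced_map_const:
  assumes "finite V" "x \<in> realization_points U" "\<Union>U \<subseteq> V"
  shows "induced_map V (\<lambda>_. a) x = (\<lambda>w. if w = a then 1 else 0)"
  using assms by (auto simp: induced_map_def mem_realization_points_iff)

text \<open>The supports of the two image points are the images of one simplex of \<open>U\<close>,
  and contiguity says that their union is a simplex of \<open>K\<close>. Precomposing with
  \<open>r\<close> yields homotopies on \<open>W\<close> instead of the realization of
  \<open>U\<close>.\<close>

lemma homotopic_induced_map_if_contiguous: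
  fixes r :: "'c::topological_space \<Rightarrow> 'a \<Rightarrow> real"
  assumes K: "abstract_simplicial_complex K" "finite (\<Union>K)"
    and V: "finite V" "\<Union>U \<subseteq> V"
    and r: "continuous_on W r" "\<And>x. x \<in> W \<Longrightarrow> r x \<in> realization_points U"
    and \<phi>\<psi>: "contiguous U K \<phi> \<psi>"
  shows "homotopic_with_canon (\<lambda>_. True) W (realization_points K)
    (induced_map V \<phi> \<circ> r) (induced_map V \<psi> \<circ> r)"
proof (rule homotopic_if_common_simplex[OF K])
  show "continuous_on W (induced_map V \<phi> \<circ> r)" "continuous_on W (induced_map V \<psi> \<circ> r)"
    using r(1) by (intro continuous_on_compose continuous_on_induced_map; simp)+
  fix x assume x: "x \<in> W"
  show "(induced_map V \<phi> \<circ> r) x \<in> realization_points K"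
    "(induced_map V \<psi> \<circ> r) x \<in> realization_points K"
    using induced_map_mem[OF V K(2) _ r(2)[OF x]] \<phi>\<psi> by (auto simp: contiguous_def)
  have "{v. r x v \<noteq> 0} \<in> U"
    using r(2)[OF x] by (simp add: realization_points_def)
  then show "{v. (induced_map V \<phi> \<circ> r) x v \<noteq> 0} \<union> {v. (induced_map V \<psi> \<circ> r) x v \<noteq> 0} \<in> K"
    using \<phi>\<psi> by (simp add: support_induced_map[OF V(1) r(2)[OF x] V(2)] contiguous_def)
qed

lemma homotopic_induced_map_if_same_contiguity_class:
  fixes r :: "'c::topological_space \<Rightarrow> 'a \<Rightarrow> real"
  assumes K: "abstract_simplicial_complex K" "finite (\<Union>K)"
    and V: "finite V" "\<Union>U \<subseteq> V"
    and r: "continuous_on W r" "\<And>x. x \<in> W \<Longrightarrow> r x \<in> realization_points U"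
    and \<phi>\<psi>: "same_contiguity_class U K \<phi> \<psi>"
  shows "homotopic_with_canon (\<lambda>_. True) W (realization_points K)
    (induced_map V \<phi> \<circ> r) (induced_map V \<psi> \<circ> r)"
proof -
  have "(contiguous U K)\<^sup>*\<^sup>* \<phi> \<psi>" and \<phi>: "simplicial_map U K \<phi>"
    using \<phi>\<psi> by (auto simp: same_contiguity_class_def)
  then show ?thesis
  proof (induction rule: rtranclp_induct)
    \<comment> \<open>A simplicial map is contiguous to itself, which supplies the reflexive case
      together with its continuity and range conditions.\<close>
    case base
    have *: "contiguous U K \<phi> \<phi>"
      using \<phi> by (auto simp: contiguous_def simplicial_map_def)
    show ?case
      by (rule homotopic_induced_map_if_contiguous[OF K V r *])
  next
    case (step \<psi> \<chi>)
    then show ?case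
      using homotopic_induced_map_if_contiguous[OF K V r] homotopic_with_trans by blast
  qed
qed

section \<open>Superlevel sets and the neighbourhood of a subcomplex\<close>

text \<open>The weight is positive exactly when \<open>\<sigma>\<close> is a superlevel set of \<open>x\<close> for a positive level.\<close>

definition superlevel_weight :: "'a set \<Rightarrow> 'a set \<Rightarrow> ('a \<Rightarrow> real) \<Rightarrow> real" where
  "superlevel_weight V \<sigma> x = (\<Prod>v\<in>\<sigma>. x v * (\<Prod>u\<in>V - \<sigma>. max 0 (x v - x u)))"

lemma superlevel_weight_nonneg:
  "(\<And>v. 0 \<le> x v) \<Longrightarrow> 0 \<le> superlevel_weight V \<sigma> x"
  by (auto simp: superlevel_weight_def intro!: prod_nonneg mult_nonneg_nonneg)

lemma superlevel_weight_nonzero_iff: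
  assumes "finite V" "finite \<sigma>" "\<And>v. 0 \<le> x v"
  shows "superlevel_weight V \<sigma> x \<noteq> 0 \<longleftrightarrow> (\<forall>v\<in>\<sigma>. x v \<noteq> 0 \<and> (\<forall>u\<in>V - \<sigma>. x u < x v))"
proof -
  have "superlevel_weight V \<sigma> x \<noteq> 0 \<longleftrightarrow> (\<forall>v\<in>\<sigma>. x v \<noteq> 0 \<and> (\<forall>u\<in>V - \<sigma>. max 0 (x v - x u) \<noteq> 0))"
    unfolding superlevel_weight_def using assms(1,2) by simp
  moreover have "max 0 (x v - x u) \<noteq> 0 \<longleftrightarrow> x u < x v" for u v
    by linarith
  ultimately show ?thesis
    by simp
qed

lemma continuous_on_superlevel_weight: "continuous_on W (superlevel_weight V \<sigma>)"
  unfolding superlevel_weight_def[abs_def]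
  by (intro continuous_intros continuous_on_max continuous_on_coordinate)

text \<open>Incomparable sets would contain vertices \<open>v\<close> and \<open>u\<close> with both
  \<open>x u < x v\<close> and \<open>x v < x u\<close>. Comparability is what later confines an
  average to a single simplex of \<open>U\<close>.\<close>

lemma superlevel_sets_chain:
  assumes "finite V" "\<And>v. 0 \<le> x v" "finite \<sigma>" "finite \<tau>" "\<sigma> \<subseteq> V" "\<tau> \<subseteq> V"
    and "superlevel_weight V \<sigma> x \<noteq> 0" "superlevel_weight V \<tau> x \<noteq> 0"
  shows "\<sigma> \<subseteq> \<tau> \<or> \<tau> \<subseteq> \<sigma>"
proof (rule ccontr)
  assume "\<not> ?thesis"
  then obtain v u where "v \<in> \<sigma> - \<tau>" "u \<in> \<tau> - \<sigma>" by auto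
  with assms have "x u < x v" "x v < x u"
    by (auto simp: superlevel_weight_nonzero_iff)
  then show False by simp
qed

text \<open>For a finite complex \<open>K\<close> and a subcomplex \<open>U\<close>, this is the
  union of the open stars, in the barycentric subdivision of \<open>K\<close>, of the barycentres of
  simplices of \<open>U\<close>.\<close>

definition superlevel_neighbourhood :: "'a set set \<Rightarrow> 'a set set \<Rightarrow> ('a \<Rightarrow> real) set" where
  "superlevel_neighbourhood K U =
     {x \<in> realization_points K. \<exists>\<sigma>\<in>U. superlevel_weight (\<Union>K) \<sigma> x \<noteq> 0}"

lemma openin_superlevel_neighbourhood:
  "openin (top_of_set (realization_points K)) (superlevel_neighbourhood K U)"
proof -
  have "open (\<Union>\<sigma>\<in>U. {x. superlevel_weight (\<Union>K) \<sigma> x \<noteq> 0})"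
    by (intro open_UN ballI open_Collect_neq continuous_on_superlevel_weight continuous_on_const)
  moreover have "superlevel_neighbourhood K U =
      realization_points K \<inter> (\<Union>\<sigma>\<in>U. {x. superlevel_weight (\<Union>K) \<sigma> x \<noteq> 0})"
    by (auto simp: superlevel_neighbourhood_def)
  ultimately show ?thesis
    by (auto simp: openin_open)
qed

text \<open>The support of \<open>x\<close> is its largest superlevel set at a positive level, and
  it belongs to \<open>U\<close>.\<close>

lemma realization_points_subset_neighbourhood:
  assumes "finite (\<Union>K)" "U \<subseteq> K"
  shows "realization_points U \<subseteq> superlevel_neighbourhood K U"
proof
  fix x assume x: "x \<in> realization_points U"
  let ?\<sigma> = "{v. x v \<noteq> 0}"
  have nonneg: "\<And>v. 0 \<le> x v" and \<sigma>: "?\<sigma> \<in> U"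
    using x by (auto simp: realization_points_def)
  then have "finite ?\<sigma>"
    using assms by (meson Union_upper finite_subset subsetD)
  then have "superlevel_weight (\<Union>K) ?\<sigma> x \<noteq> 0"
    using nonneg assms(1) by (auto simp: superlevel_weight_nonzero_iff order_less_le)
  then show "x \<in> superlevel_neighbourhood K U"
    using \<sigma> x realization_points_mono[OF assms(2)] by (auto simp: superlevel_neighbourhood_def)
qed

section \<open>The map from the neighbourhood to the subcomplex\<close>

text \<open>For nonempty finite simplices inside \<open>V\<close> and a nonzero denominator, this
  combines the barycentres of the simplices \<open>\<sigma>\<close> of \<open>U\<close> with
  coefficients proportional to \<open>card \<sigma> * superlevel_weight V \<sigma> x\<close>. The
  denominator is the total of the numerators over \<open>v\<close> in \<open>V\<close>.\<close>

definition superlevel_average :: "'a set \<Rightarrow> 'a set set \<Rightarrow> ('a \<Rightarrow> real) \<Rightarrow> 'a \<Rightarrow> real" where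
  "superlevel_average V U x v =
     (\<Sum>\<sigma>\<in>U. if v \<in> \<sigma> then superlevel_weight V \<sigma> x else 0) /
     (\<Sum>\<sigma>\<in>U. real (card \<sigma>) * superlevel_weight V \<sigma> x)"

context
  fixes K U :: "'a set set"
  assumes K: "abstract_simplicial_complex K" and fin: "finite K" and U: "subcomplex U K"
begin

lemma finite_subcomplex: "finite U"
  using U fin finite_subset by (auto simp: subcomplex_def)

lemma subcomplex_simplex:
  assumes "\<sigma> \<in> U"
  shows "finite \<sigma>" "\<sigma> \<noteq> {}" "\<sigma> \<subseteq> \<Union>K"
  using assms U unfolding subcomplex_def abstract_simplicial_complex_def by blast+

text \<open>Membership in the neighbourhood provides one positive summand, so the division in
  \<open>superlevel_average\<close> is legitimate.\<close>

lemma normalizer_pos: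
  assumes x: "x \<in> superlevel_neighbourhood K U"
  shows "0 < (\<Sum>\<sigma>\<in>U. real (card \<sigma>) * superlevel_weight (\<Union>K) \<sigma> x)"
proof -
  have nonneg: "\<And>v. 0 \<le> x v"
    using x by (auto simp: superlevel_neighbourhood_def realization_points_def)
  obtain \<sigma> where \<sigma>: "\<sigma> \<in> U" "superlevel_weight (\<Union>K) \<sigma> x \<noteq> 0"
    using x by (auto simp: superlevel_neighbourhood_def)
  then have "0 < superlevel_weight (\<Union>K) \<sigma> x"
    using superlevel_weight_nonneg[of x "\<Union>K" \<sigma>] nonneg by simp
  moreover have "0 < card \<sigma>"
    using subcomplex_simplex[OF \<sigma>(1)] by (simp add: card_gt_0_iff)
  ultimately show ?thesis
    using \<sigma>(1) by (intro sum_pos2[OF finite_subcomplex])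
      (auto intro!: mult_nonneg_nonneg superlevel_weight_nonneg nonneg)
qed

lemma support_superlevel_average:
  assumes x: "x \<in> superlevel_neighbourhood K U"
  shows "{v. superlevel_average (\<Union>K) U x v \<noteq> 0} = \<Union>{\<sigma>\<in>U. superlevel_weight (\<Union>K) \<sigma> x \<noteq> 0}"
proof -
  have nonneg: "\<And>v. 0 \<le> x v"
    using x by (auto simp: superlevel_neighbourhood_def realization_points_def)
  have "(\<Sum>\<sigma>\<in>U. if v \<in> \<sigma> then superlevel_weight (\<Union>K) \<sigma> x else 0) \<noteq> 0
      \<longleftrightarrow> v \<in> \<Union>{\<sigma>\<in>U. superlevel_weight (\<Union>K) \<sigma> x \<noteq> 0}" for v
    by (subst sum_nonneg_eq_0_iff[OF finite_subcomplex])
      (auto simp: superlevel_weight_nonneg nonneg)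
  then show ?thesis
    using normalizer_pos[OF x] by (auto simp: superlevel_average_def)
qed

text \<open>The simplices of \<open>U\<close> with nonzero weight form a finite nonempty chain, so
  their union is the largest of them.\<close>

lemma support_superlevel_average_mem:
  assumes x: "x \<in> superlevel_neighbourhood K U"
  shows "{v. superlevel_average (\<Union>K) U x v \<noteq> 0} \<in> U"
proof -
  let ?C = "{\<sigma>\<in>U. superlevel_weight (\<Union>K) \<sigma> x \<noteq> 0}"
  have nonneg: "\<And>v. 0 \<le> x v"
    using x by (auto simp: superlevel_neighbourhood_def realization_points_def)
  have "\<sigma> \<subseteq> \<tau> \<or> \<tau> \<subseteq> \<sigma>" if "\<sigma> \<in> ?C" "\<tau> \<in> ?C" for \<sigma> \<tau>
    using that nonneg subcomplex_simplex(1,3)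
    by (intro superlevel_sets_chain[OF finite_vertices[OF K fin], of x]) simp_all
  then have "subset.chain UNIV ?C"
    by (simp add: subset_chain_def)
  moreover have "?C \<noteq> {}" "finite ?C"
    using x finite_subcomplex by (auto simp: superlevel_neighbourhood_def)
  ultimately have "\<Union>?C \<in> ?C"
    by (intro Union_in_chain)
  then show ?thesis
    by (simp add: support_superlevel_average[OF x])
qed

lemma superlevel_average_mem:
  assumes x: "x \<in> superlevel_neighbourhood K U"
  shows "superlevel_average (\<Union>K) U x \<in> realization_points U"
proof -
  have nonneg: "\<And>v. 0 \<le> x v"
    using x by (auto simp: superlevel_neighbourhood_def realization_points_def)
  have "(\<Sum>v\<in>\<Union>K. \<Sum>\<sigma>\<in>U. if v \<in> \<sigma> then superlevel_weight (\<Union>K) \<sigma> x else 0)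
      = (\<Sum>\<sigma>\<in>U. \<Sum>v\<in>\<Union>K. if v \<in> \<sigma> then superlevel_weight (\<Union>K) \<sigma> x else 0)"
    by (rule sum.swap)
  \<comment> \<open>The weight of \<open>\<sigma>\<close> is counted once for each of its vertices,
    all of which lie in the vertex set of \<open>K\<close>.\<close>
  also have "\<dots> = (\<Sum>\<sigma>\<in>U. real (card \<sigma>) * superlevel_weight (\<Union>K) \<sigma> x)"
    using subcomplex_simplex
    by (intro sum.cong refl)
      (simp add: Int_absorb1 flip: sum.inter_restrict[OF finite_vertices[OF K fin]])
  finally have "sum (superlevel_average (\<Union>K) U x) (\<Union>K) = 1"
    using normalizer_pos[OF x] by (simp add: superlevel_average_def flip: sum_divide_distrib)
  moreover have "\<Union>U \<subseteq> \<Union>K"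
    using U by (auto simp: subcomplex_def)
  moreover have "0 \<le> superlevel_average (\<Union>K) U x v" for v
    unfolding superlevel_average_def using normalizer_pos[OF x]
    by (intro divide_nonneg_pos sum_nonneg) (auto simp: superlevel_weight_nonneg nonneg)
  ultimately show ?thesis
    using support_superlevel_average_mem[OF x]
    by (simp add: mem_realization_points_iff[OF finite_vertices[OF K fin]])
qed

lemma continuous_on_superlevel_average:
  "continuous_on (superlevel_neighbourhood K U) (superlevel_average (\<Union>K) U)"
  unfolding superlevel_average_def[abs_def]
proof (intro continuous_on_coordinatewise_then_product continuous_intros)
  fix v \<sigma>
  show "continuous_on (superlevel_neighbourhood K U)
      (\<lambda>x. if v \<in> \<sigma> then superlevel_weight (\<Union>K) \<sigma> x else 0)"
    using continuous_on_superlevel_weight by (cases "v \<in> \<sigma>") auto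
  show "continuous_on (superlevel_neighbourhood K U) (superlevel_weight (\<Union>K) \<sigma>)"
    by (rule continuous_on_superlevel_weight)
next
  show "\<forall>x\<in>superlevel_neighbourhood K U.
      (\<Sum>\<sigma>\<in>U. real (card \<sigma>) * superlevel_weight (\<Union>K) \<sigma> x) \<noteq> 0"
    using normalizer_pos by (metis order_less_irrefl)
qed

text \<open>The factor \<open>x v\<close> in the weight excludes simplices with a vertex where
  \<open>x\<close> vanishes. Hence the support of the average lies in that of \<open>x\<close>, and
  the latter is the common simplex.\<close>

lemma homotopic_id_superlevel_average:
  "homotopic_with_canon (\<lambda>_. True) (superlevel_neighbourhood K U) (realization_points K)
     id (superlevel_average (\<Union>K) U)"
proof (rule homotopic_if_common_simplex[OF K finite_vertices[OF K fin]])
  fix x assume x: "x \<in> superlevel_neighbourhood K U"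
  show idx: "id x \<in> realization_points K"
    using x by (auto simp: superlevel_neighbourhood_def)
  show "superlevel_average (\<Union>K) U x \<in> realization_points K"
    using superlevel_average_mem[OF x] realization_points_mono U by (auto simp: subcomplex_def)
  have nonneg: "\<And>v. 0 \<le> x v"
    using idx by (auto simp: realization_points_def)
  have "{v. superlevel_average (\<Union>K) U x v \<noteq> 0} \<subseteq> {v. x v \<noteq> 0}"
    using subcomplex_simplex unfolding support_superlevel_average[OF x]
    by (auto simp: superlevel_weight_nonzero_iff[OF finite_vertices[OF K fin] _ nonneg])
  then show "{v. id x v \<noteq> 0} \<union> {v. superlevel_average (\<Union>K) U x v \<noteq> 0} \<in> K"
    using idx by (simp add: Un_absorb2 realization_points_def)
qed (auto intro: continuous_on_superlevel_average)

end

section \<open>Contracting the neighbourhoods and comparing covers\<close>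

text \<open>Two homotopies are joined: from the inclusion to the averaging map, then along the
  contiguity chain to a constant.\<close>

lemma categorical_open_superlevel_neighbourhood:
  assumes K: "abstract_simplicial_complex K" "finite K" and cat: "categorical_subcomplex K U"
  shows "categorical_open (geometric_realization K) (superlevel_neighbourhood K U)"
proof -
  let ?V = "\<Union>K" and ?W = "superlevel_neighbourhood K U" and ?P = "realization_points K"
  let ?r = "superlevel_average ?V U"
  obtain a where U: "subcomplex U K" and a: "a \<in> ?V"
    and contig: "same_contiguity_class U K id (\<lambda>_. a)"
    using cat by (auto simp: categorical_subcomplex_def)
  \<comment> \<open>The vertex \<open>a\<close> viewed as a point of the realization.\<close>
  let ?a = "\<lambda>w. if w = a then 1 else 0 :: real"
  have fin: "finite ?V" and sub: "\<Union>U \<subseteq> ?V"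
    using finite_vertices[OF K] U by (auto simp: subcomplex_def)
  note r = superlevel_average_mem[OF K U]
  have "homotopic_with_canon (\<lambda>_. True) ?W ?P (induced_map ?V id \<circ> ?r) (induced_map ?V (\<lambda>_. a) \<circ> ?r)"
    by (rule homotopic_induced_map_if_same_contiguity_class[OF K(1) fin fin sub
          continuous_on_superlevel_average[OF K U] r contig])
  then have "homotopic_with_canon (\<lambda>_. True) ?W ?P ?r (\<lambda>_. ?a)"
    by (rule homotopic_with_eq)
      (auto simp: induced_map_id[OF fin r sub] induced_map_const[OF fin r sub])
  with homotopic_id_superlevel_average[OF K U]
  have "homotopic_with_canon (\<lambda>_. True) ?W ?P id (\<lambda>_. ?a)"
    by (rule homotopic_with_trans)
  moreover have "?a \<in> ?P"
  proof -
    obtain \<sigma> where \<sigma>: "\<sigma> \<in> K" "a \<in> \<sigma>" using a by auto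
    then have "{a} \<in> K" by (intro face_mem[OF K(1) \<sigma>(1)]) auto
    then show ?thesis by (simp add: realization_points_def)
  qed
  moreover have "?W \<subseteq> ?P"
    by (auto simp: superlevel_neighbourhood_def)
  ultimately show ?thesis
    unfolding categorical_open_def geometric_realization_eq
    by (intro conjI bexI[of _ ?a] openin_superlevel_neighbourhood)
      (simp_all add: subtopology_subtopology Int_absorb1)
qed

theorem theorem4p2p1:
  fixes K :: "'a set set"
  assumes "abstract_simplicial_complex K"
    and "finite K"
  shows "LS_cat (geometric_realization K) \<le> scat K"
  unfolding LS_cat_def scat_def
\<comment> \<open>Every \<open>n\<close> admissible for \<open>scat\<close> is shown to be
  admissible for \<open>LS_cat\<close>; if there is none, \<open>scat K\<close> is infinite and the
  bound is trivial.\<close>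
proof (intro Inf_superset_mono subsetI)
  fix e assume "e \<in> {enat n | n. \<exists>U :: nat \<Rightarrow> 'a set set.
     (\<forall>i\<le>n. categorical_subcomplex K (U i)) \<and> K = (\<Union>i\<le>n. U i)}"
  then obtain n and U :: "nat \<Rightarrow> 'a set set"
    where e: "e = enat n" and cat: "\<forall>i\<le>n. categorical_subcomplex K (U i)" and K: "K = (\<Union>i\<le>n. U i)"
    by blast
  let ?W = "\<lambda>i. superlevel_neighbourhood K (U i)"
  \<comment> \<open>The support of a point is a simplex of some \<open>U i\<close>, so the point
    already lies in the realization of that \<open>U i\<close>.\<close>
  have "realization_points K \<subseteq> (\<Union>i\<le>n. ?W i)"
  proof
    fix x assume x: "x \<in> realization_points K"
    then have "{v. x v \<noteq> 0} \<in> (\<Union>i\<le>n. U i)"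
      using K by (auto simp: realization_points_def)
    then obtain i where i: "i \<le> n" "{v. x v \<noteq> 0} \<in> U i"
      by auto
    then have "x \<in> realization_points (U i)"
      using x by (auto simp: realization_points_def)
    moreover have "U i \<subseteq> K"
      using cat i by (auto simp: categorical_subcomplex_def subcomplex_def)
    ultimately show "x \<in> (\<Union>i\<le>n. ?W i)"
      using realization_points_subset_neighbourhood[OF finite_vertices[OF assms]] i by blast
  qed
  then have "topspace (geometric_realization K) = (\<Union>i\<le>n. ?W i)"
    by (auto simp: geometric_realization_eq superlevel_neighbourhood_def)
  moreover have "\<forall>i\<le>n. categorical_open (geometric_realization K) (?W i)"
    using cat categorical_open_superlevel_neighbourhood[OF assms] by auto
  ultimately show "e \<in> {enat n | n. \<exists>W. (\<forall>i\<le>n. categorical_open (geometric_realization K) (W i)) \<and>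
      topspace (geometric_realization K) = (\<Union>i\<le>n. W i)}"
    unfolding e mem_Collect_eq by (intro exI[of _ n] exI[of _ ?W] conjI refl)
qed

end
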